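(* Let $t\ge 1$ be an integer and let $G$ be a $\chi_t$-critical graph whose $t$-complement $\overline{G}^t$ is connected. Then $|G|\ge 2\chi_t(G)-1$. Equivalently: if $G$ is a $\chi_t$-critical graph with $|G|\le 2\chi_t(G)-2$, then $G$ is $t$-decomposable, i.e. there are two non-empty disjoint subgraphs $G_1,G_2$ of $G$ such that $G$ is obtained from $G_1\cup G_2$ by joining each vertex of $G_1$ to each vertex of $G_2$ by exactly $t$ parallel edges.
   Context: All graphs are finite, undirected, loopless, and may have multiple edges; $|G|$ is the number of vertices and degrees count edges with multiplicity. $\mu_G(u,v)$ is the number of edges joining $u$ and $v$, and $\mu(G)=\max_{u\ne v}\mu_G(u,v)$. For an integer $t\ge1$, a graph is strictly $t$-degenerate if every non-empty subgraph $H$ of it has a vertex of degree at most $t-1$ in $H$. The point partition number $\chi_t(G)$ is the least $k\ge 0$ such that $V(G)$ can be colored with $k$ colors so that each color class induces a strictly $t$-degenerate subgraph. $G$ is $\chi_t$-critical if $\chi_t(G')<\chi_t(G)$ for every proper subgraph $G'$ of $G$. For a graph $G$ with $\mu(G)\le t$, the $t$-complement $\overline{G}^t$ is the graph on $V(G)$ with $\mu_{\overline{G}^t}(u,v)=t-\mu_G(u,v)$ for all distinct $u,v$. Such a $G$ is $t$-decomposable if it is the Dirac $t$-join of two non-empty disjoint subgraphs $G_1,G_2$, meaning $G$ arises from the disjoint union $G_1\cup G_2$ by adding edges so that $\mu_G(u,v)=t$ for all $u\in V(G_1)$, $v\in V(G_2)$ (equivalently, $\overline{G}^t$ is disconnected).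 (A $\chi_t$-critical graph satisfies $\mu(G)\le t$.) *)

theory Defs
  imports Complex_Main "HOL-Library.Multiset"
begin

text \<open>A multigraph is a vertex set together with a multiset of edges, each edge being the
  two-element set of its ends; parallel edges are repeated elements of the multiset.\<close>

record 'a multigraph =
  verts :: "'a set"
  edges :: "'a set multiset"

definition multigraph :: "'a multigraph \<Rightarrow> bool" where
  "multigraph G \<longleftrightarrow>
     finite (verts G) \<and> (\<forall>e \<in># edges G. e \<subseteq> verts G \<and> card e = 2)"

definition mult :: "'a multigraph \<Rightarrow> 'a \<Rightarrow> 'a \<Rightarrow> nat" where
  "mult G u v = count (edges G) {u, v}"

definition degree :: "'a multigraph \<Rightarrow> 'a \<Rightarrow> nat" where
  "degree G v = size {# e \<in># edges G. v \<in> e #}"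

definition subgraph :: "'a multigraph \<Rightarrow> 'a multigraph \<Rightarrow> bool" where
  "subgraph H G \<longleftrightarrow> multigraph H \<and> verts H \<subseteq> verts G \<and> edges H \<subseteq># edges G"

definition induced_subgraph :: "'a multigraph \<Rightarrow> 'a set \<Rightarrow> 'a multigraph" where
  "induced_subgraph G X =
     \<lparr> verts = verts G \<inter> X, edges = {# e \<in># edges G. e \<subseteq> X #} \<rparr>"

definition strictly_degenerate :: "nat \<Rightarrow> 'a multigraph \<Rightarrow> bool" where
  "strictly_degenerate t G \<longleftrightarrow>
     (\<forall>H. subgraph H G \<and> verts H \<noteq> {} \<longrightarrow> (\<exists>v \<in> verts H. degree H v \<le> t - 1))"

definition point_partition :: "nat \<Rightarrow> nat \<Rightarrow> 'a multigraph \<Rightarrow> ('a \<Rightarrow> nat) \<Rightarrow> bool" where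
  "point_partition t k G c \<longleftrightarrow>
     (\<forall>v \<in> verts G. c v < k) \<and>
     (\<forall>i < k. strictly_degenerate t (induced_subgraph G {v \<in> verts G. c v = i}))"

text \<open>For \<open>t \<ge> 1\<close> the minimum below is attained, since colouring all vertices differently is
  admissible. For \<open>t = 0\<close> the value carries no meaning.\<close>

definition point_partition_number :: "nat \<Rightarrow> 'a multigraph \<Rightarrow> nat" where
  "point_partition_number t G = (LEAST k. \<exists>c. point_partition t k G c)"

definition chi_critical :: "nat \<Rightarrow> 'a multigraph \<Rightarrow> bool" where
  "chi_critical t G \<longleftrightarrow>
     (\<forall>G'. subgraph G' G \<and> G' \<noteq> G \<longrightarrow>
        point_partition_number t G' < point_partition_number t G)"

text \<open>The complement is meant for graphs with all multiplicities at most \<open>t\<close>; beyond that the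
  subtraction of natural numbers truncates.\<close>

definition t_complement :: "nat \<Rightarrow> 'a multigraph \<Rightarrow> 'a multigraph" where
  "t_complement t G =
     \<lparr> verts = verts G,
       edges = (\<Sum>e \<in> {e. e \<subseteq> verts G \<and> card e = 2}.
                  replicate_mset (t - count (edges G) e) e) \<rparr>"

text \<open>The empty graph counts as connected, so that a graph is disconnected exactly if its
  vertices can be split into two non-empty parts with no edge between them.\<close>

definition connected_graph :: "'a multigraph \<Rightarrow> bool" where
  "connected_graph G \<longleftrightarrow>
     (\<forall>u \<in> verts G. \<forall>v \<in> verts G. (u, v) \<in> {(x, y). mult G x y > 0}\<^sup>*)"

definition dirac_join :: "nat \<Rightarrow> 'a multigraph \<Rightarrow> 'a multigraph \<Rightarrow> 'a multigraph" where
  "dirac_join t G1 G2 =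
     \<lparr> verts = verts G1 \<union> verts G2,
       edges = edges G1 + edges G2 +
         (\<Sum>(u, v) \<in> verts G1 \<times> verts G2. replicate_mset t {u, v}) \<rparr>"

definition t_decomposable :: "nat \<Rightarrow> 'a multigraph \<Rightarrow> bool" where
  "t_decomposable t G \<longleftrightarrow>
     (\<exists>G1 G2. subgraph G1 G \<and> subgraph G2 G \<and>
        verts G1 \<noteq> {} \<and> verts G2 \<noteq> {} \<and> verts G1 \<inter> verts G2 = {} \<and>
        G = dirac_join t G1 G2)"

lemma mult_t_complement:
  assumes "multigraph G" "u \<in> verts G" "v \<in> verts G" "u \<noteq> v"
  shows "mult (t_complement t G) u v = t - mult G u v"
proof -
  have "finite {e. e \<subseteq> verts G \<and> card e = 2}"
    using assms(1) by (simp add: multigraph_def)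
  then show ?thesis
    using assms by (simp add: mult_def t_complement_def count_sum)
qed

lemma mult_dirac_join:
  assumes "multigraph G1" "multigraph G2" "verts G1 \<inter> verts G2 = {}"
    and "u \<in> verts G1" "v \<in> verts G2"
  shows "mult (dirac_join t G1 G2) u v = t"
proof -
  have fin: "finite (verts G1 \<times> verts G2)"
    using assms(1,2) by (simp add: multigraph_def)
  have "{u, v} \<notin># edges G1" "{u, v} \<notin># edges G2"
    using assms unfolding multigraph_def by blast+
  then have zero: "count (edges G1) {u, v} = 0" "count (edges G2) {u, v} = 0"
    by (simp_all add: not_in_iff)
  have "count (case p of (x, y) \<Rightarrow> replicate_mset t {x, y}) {u, v}
      = (if p = (u, v) then t else 0)" if p: "p \<in> verts G1 \<times> verts G2" for p
  proof -
    obtain x y where xy: "p = (x, y)" "x \<in> verts G1" "y \<in> verts G2"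
      using p by blast
    have "{u, v} = {x, y} \<longleftrightarrow> x = u \<and> y = v"
      unfolding doubleton_eq_iff using xy assms(3-5) by blast
    then show ?thesis
      using xy(1) by simp
  qed
  then have "(\<Sum>p \<in> verts G1 \<times> verts G2.
      count (case p of (x, y) \<Rightarrow> replicate_mset t {x, y}) {u, v})
    = (\<Sum>p \<in> verts G1 \<times> verts G2. if p = (u, v) then t else 0)"
    by (rule sum.cong[OF refl])
  then show ?thesis
    using zero fin assms(4,5) by (simp add: mult_def dirac_join_def count_sum)
qed

end

(* The argument only uses the family of vertex sets that induce strictly t-degenerate subgraphs,
   which is closed under non-empty subsets, and the graph of its two-element members (the pairs of
   multiplicity less than t), which is connected when the t-complement is. Take a partition of the
   vertices into k such sets, k the point partition number, with as few singletons as possible. If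
   it has at most one singleton, then |G| >= 2k - 1. Otherwise let W be the set of vertices outside
   the classes with at least three elements; the classes of size two form a maximum matching of W
   that misses at least two vertices. By Gallai-Edmonds theory for W there is a set A of vertices such that
   G - A still needs k colours. If A is non-empty, this contradicts criticality. If A is empty, then
   the vertices missed by maximum matchings of W are closed under adjacency, hence are all vertices,
   and by Gallai's lemma a maximum matching misses at most one of them.

   The second statement is the contrapositive: criticality bounds all multiplicities by t, so a
   disconnected t-complement means that G is a Dirac t-join. *)

theory Submission
  imports Defs "HOL-Library.Disjoint_Sets"
begin

section \<open>Matchings in a finite simple graph\<close>

locale matching_graph =
  fixes V :: "'a set" and E :: "'a set set"
  assumes finite_V: "finite V"
    and edgeD: "e \<in> E \<Longrightarrow> e \<subseteq> V \<and> card e = 2"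
begin

definition matching :: "'a set \<Rightarrow> 'a set set \<Rightarrow> bool" where
  "matching X M \<longleftrightarrow> M \<subseteq> E \<inter> Pow X \<and> disjoint M"

definition matching_number :: "'a set \<Rightarrow> nat" where
  "matching_number X = Max (card ` {M. matching X M})"

definition max_matching :: "'a set \<Rightarrow> 'a set set \<Rightarrow> bool" where
  "max_matching X M \<longleftrightarrow> matching X M \<and> card M = matching_number X"

text \<open>The set \<open>D\<close> of the Gallai-Edmonds decomposition of the subgraph induced by
  \<open>X\<close>.\<close>

definition missable :: "'a set \<Rightarrow> 'a set" where
  "missable X = {x \<in> X. \<exists>M. max_matching X M \<and> x \<notin> \<Union>M}"

lemma finite_E: "finite E"
  by (rule finite_subset[of _ "Pow V"]) (use edgeD finite_V in auto)

lemma edge_other: assumes "e \<in> E" "y \<in> e" obtains p where "p \<noteq> y" "e = {y, p}"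
proof -
  have "card e = 2" using assms edgeD by blast
  then obtain a b where "e = {a, b}" "a \<noteq> b" by (meson card_2_iff)
  then show thesis using assms(2) that[of a] that[of b] by auto
qed

lemma edge_distinct: "{x, y} \<in> E \<Longrightarrow> x \<noteq> y"
  using edgeD[of "{x, y}"] by auto

lemma finite_matching: "matching X M \<Longrightarrow> finite M"
  unfolding matching_def using finite_E finite_subset by blast

lemma matching_unique:
  "matching X M \<Longrightarrow> e \<in> M \<Longrightarrow> f \<in> M \<Longrightarrow> y \<in> e \<Longrightarrow> y \<in> f \<Longrightarrow> e = f"
  unfolding matching_def disjoint_def by blast

lemma card_Union_matching:
  assumes "matching X M" shows "card (\<Union>M) = 2 * card M"
proof -
  have "card (\<Union>M) = sum card M"
    using assms edgeD finite_V unfolding matching_def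
    by (intro card_Union_disjoint) (auto intro: finite_subset)
  also have "\<dots> = sum (\<lambda>_. 2) M"
    using assms edgeD unfolding matching_def by (intro sum.cong) auto
  finally show ?thesis by simp
qed

lemma finite_Union_matching: "matching X M \<Longrightarrow> finite (\<Union>M)"
  using finite_V edgeD unfolding matching_def by (meson Union_least finite_subset le_infE subsetD)

lemma Union_matching_subset: "matching X M \<Longrightarrow> \<Union>M \<subseteq> X"
  unfolding matching_def by auto

lemma finite_matchings: "finite {M. matching X M}"
  by (rule finite_subset[of _ "Pow E"]) (auto simp: matching_def finite_E)

lemma card_le_matching_number: "matching X M \<Longrightarrow> card M \<le> matching_number X"
  unfolding matching_number_def using finite_matchings by (intro Max_ge) auto

lemma ex_max_matching: "\<exists>M. max_matching X M"
proof -
  have "matching X {}" by (auto simp: matching_def)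
  then have "matching_number X \<in> card ` {M. matching X M}"
    unfolding matching_number_def using finite_matchings by (intro Max_in) auto
  then show ?thesis by (auto simp: max_matching_def)
qed

lemma matching_mono: "matching X M \<Longrightarrow> X \<subseteq> Y \<Longrightarrow> matching Y M"
  unfolding matching_def by auto

lemma matching_subset: "matching X M \<Longrightarrow> N \<subseteq> M \<Longrightarrow> \<Union>N \<subseteq> Y \<Longrightarrow> matching Y N"
  unfolding matching_def by (auto intro: pairwise_subset)

lemma matching_partner:
  assumes "matching X M" "y \<in> \<Union>M" obtains p where "{y, p} \<in> M"
proof -
  obtain e where e: "e \<in> M" "y \<in> e" using assms by auto
  then have "e \<in> E" using assms(1) by (auto simp: matching_def)
  then obtain p where "e = {y, p}" using edge_other e(2) by blast
  then show thesis using that e(1) by simp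
qed

lemma matching_insert:
  assumes "matching X M" "{y, p} \<in> E" "y \<in> X" "p \<in> X" "y \<notin> \<Union>M" "p \<notin> \<Union>M"
  shows "matching X (insert {y, p} M)" "card (insert {y, p} M) = Suc (card M)"
proof -
  show "matching X (insert {y, p} M)"
    using assms unfolding matching_def by (auto simp: pairwise_insert disjnt_def)
  show "card (insert {y, p} M) = Suc (card M)"
    using assms finite_matching by (intro card_insert_disjoint) auto
qed

section \<open>Augmentation, exchange and Gallai's lemma\<close>

lemma max_matching_no_augment:
  assumes "max_matching X M" "{y, p} \<in> E" "y \<in> X" "p \<in> X" "y \<notin> \<Union>M"
  shows "p \<in> \<Union>M"
  using matching_insert[of X M y p] card_le_matching_number[of X "insert {y, p} M"] assms
  unfolding max_matching_def by (metis Suc_n_not_le_n)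

text \<open>One step along an alternating path: the edge of \<open>M\<close> at \<open>p\<close>
  gives way to the edge of \<open>N\<close> at \<open>p\<close>. The missed vertex moves from
  \<open>y\<close> to \<open>q\<close>, and the new matching is closer to \<open>N\<close>, which is
  impossible once closeness has been maximised.\<close>

lemma exchange:
  assumes "matching X M" "matching X N" "{y, p} \<in> N" "{p, q} \<in> M" "y \<notin> \<Union>M"
  defines "M' \<equiv> insert {y, p} (M - {{p, q}})"
  shows "matching X M'" "card M' = card M" "card (M \<inter> N) < card (M' \<inter> N)"
    "\<Union>M' = insert y (\<Union>M) - {q}"
proof -
  have E: "{y, p} \<in> E" "{p, q} \<in> E" "{y, p} \<subseteq> X"
    using assms unfolding matching_def by auto
  have "p \<noteq> q" "y \<noteq> p" "q \<noteq> y"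
    using edge_distinct E assms(4,5) by auto
  have un: "e = {p, q}" if "e \<in> M" "p \<in> e \<or> q \<in> e" for e
    using matching_unique[OF assms(1)] that assms(4) by blast
  have U: "\<Union>(M - {{p, q}}) = \<Union>M - {p, q}"
    using un assms(4) by blast
  have m: "matching X (M - {{p, q}})"
    using Union_matching_subset[OF assms(1)] by (intro matching_subset[OF assms(1)]) auto
  have np: "p \<notin> \<Union>(M - {{p, q}})" "y \<notin> \<Union>(M - {{p, q}})"
    using U assms(5) by auto
  show "matching X M'"
    unfolding M'_def using matching_insert(1)[OF m] E np by auto
  have "card M' = Suc (card (M - {{p, q}}))"
    unfolding M'_def using matching_insert(2)[OF m] E np by auto
  also have "\<dots> = card M"
    using assms(4) finite_matching[OF assms(1)] by (metis card_Suc_Diff1)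
  finally show "card M' = card M" .
  \<comment> \<open>\<open>N\<close> already covers \<open>p\<close> by \<open>{y, p}\<close>, so
    dropping \<open>{p, q}\<close> costs no common edge.\<close>
  have "{p, q} \<notin> N"
    using matching_unique[OF assms(2,3), of "{p, q}" p] \<open>q \<noteq> y\<close> \<open>p \<noteq> q\<close> by (auto simp: doubleton_eq_iff)
  then have "M' \<inter> N = insert {y, p} (M \<inter> N)"
    unfolding M'_def using assms(3) by auto
  moreover have "{y, p} \<notin> M" using assms(5) by auto
  ultimately show "card (M \<inter> N) < card (M' \<inter> N)"
    using finite_matching[OF assms(1)] by auto
  show "\<Union>M' = insert y (\<Union>M) - {q}"
    unfolding M'_def Union_insert U using assms(4) \<open>q \<noteq> y\<close> \<open>p \<noteq> q\<close> by auto
qed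

text \<open>Transporting \<open>N\<close> step by step along an alternating path towards \<open>M\<close> is expressed by
  choosing \<open>N\<close> with \<open>card (N \<inter> M)\<close> maximal.\<close>

lemma ex_closest_matching:
  assumes "P N" "\<And>N. P N \<Longrightarrow> matching X N"
  obtains N where "P N" "\<And>N'. P N' \<Longrightarrow> card (N' \<inter> M) \<le> card (N \<inter> M)"
proof -
  have "\<forall>N. P N \<longrightarrow> card (N \<inter> M) \<le> card E"
  proof (intro allI impI)
    fix N assume "P N"
    then have "N \<subseteq> E" using assms(2) by (auto simp: matching_def)
    then show "card (N \<inter> M) \<le> card E" by (intro card_mono finite_E) auto
  qed
  then obtain N where "P N \<and> (\<forall>N'. P N' \<longrightarrow> card (N' \<inter> M) \<le> card (N \<inter> M))"
    using ex_has_greatest_nat[of P N "\<lambda>N. card (N \<inter> M)" "Suc (card E)"] assms(1)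
    by (auto simp: less_Suc_eq_le)
  then show thesis using that by blast
qed

text \<open>Suppose \<open>M\<close> misses \<open>u\<close> and \<open>v\<close>. Among the maximum
  matchings missing \<open>w\<close>, take \<open>N\<close> closest to \<open>M\<close>. It covers
  every vertex of \<open>M\<close> other than \<open>w\<close>, since an exchange at an uncovered
  one would bring it closer while still missing \<open>w\<close>. It also covers \<open>u\<close>
  and \<open>v\<close>, hence more vertices than \<open>M\<close>.\<close>

lemma missed_trans:
  assumes w: "w \<in> missable X"
    and uw: "\<And>M. max_matching X M \<Longrightarrow> u \<in> \<Union>M \<or> w \<in> \<Union>M"
    and vw: "\<And>M. max_matching X M \<Longrightarrow> v \<in> \<Union>M \<or> w \<in> \<Union>M"
    and "u \<noteq> v" and M: "max_matching X M"
  shows "u \<in> \<Union>M \<or> v \<in> \<Union>M"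
proof (rule ccontr)
  assume miss: "\<not> ?thesis"
  let ?P = "\<lambda>N. max_matching X N \<and> w \<notin> \<Union>N"
  from w obtain N0 where "?P N0" by (auto simp: missable_def)
  then obtain N where N: "?P N" and best: "\<And>N'. ?P N' \<Longrightarrow> card (N' \<inter> M) \<le> card (N \<inter> M)"
    by (rule ex_closest_matching[where X = X]) (auto simp: max_matching_def)
  have mM: "matching X M" and mN: "matching X N" and eq: "card M = card N"
    using M N by (auto simp: max_matching_def)
  have "\<Union>M - {w} \<subseteq> \<Union>N"
  proof
    fix x assume x: "x \<in> \<Union>M - {w}"
    show "x \<in> \<Union>N"
    proof (rule ccontr)
      assume nx: "x \<notin> \<Union>N"
      obtain p where p: "{x, p} \<in> M" using matching_partner[OF mM] x by blast
      then have "{x, p} \<in> E" "x \<in> X" "p \<in> X" using mM by (auto simp: matching_def)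
      then have "p \<in> \<Union>N" using max_matching_no_augment[of X N x p] N nx by blast
      then obtain q where q: "{p, q} \<in> N" using matching_partner[OF mN] by blast
      note ex = exchange[OF mN mM p q nx]
      have "?P (insert {x, p} (N - {{p, q}}))"
        using ex N x unfolding max_matching_def by auto
      from best[OF this] ex(3) show False by linarith
    qed
  qed
  moreover have "u \<in> \<Union>N" "v \<in> \<Union>N" using uw vw N by auto
  ultimately have "insert u (insert v (\<Union>M - {w})) \<subseteq> \<Union>N" by blast
  moreover have "card (insert u (insert v (\<Union>M - {w}))) > card (\<Union>M)"
  proof -
    have "w \<in> \<Union>M" using uw M miss by auto
    then have "card (\<Union>M) = Suc (card (\<Union>M - {w}))"
      using finite_Union_matching[OF mM] by (metis card_Suc_Diff1)
    moreover have "u \<notin> \<Union>M" "v \<notin> \<Union>M" using miss by auto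
    ultimately show ?thesis using finite_Union_matching[OF mM] \<open>u \<noteq> v\<close> by simp
  qed
  ultimately have "card (\<Union>M) < card (\<Union>N)"
    using finite_Union_matching[OF mN] by (meson card_mono less_le_trans)
  then show False using card_Union_matching[OF mM] card_Union_matching[OF mN] eq by simp
qed

text \<open>On \<open>missable X\<close>, the classes of its reflexive transitive closure are the
  components of the induced graph.\<close>

definition missable_links :: "'a set \<Rightarrow> ('a \<times> 'a) set" where
  "missable_links X = {(x, y). x \<in> missable X \<and> y \<in> missable X \<and> {x, y} \<in> E}"

text \<open>Gallai's lemma for the components of \<open>missable X\<close>. Two adjacent vertices
  missed together would augment the matching; \<open>missed_trans\<close> then carries the property
  along a path.\<close>

lemma linked_not_both_missed:
  assumes "(u, v) \<in> (missable_links X)\<^sup>*" "u \<noteq> v" "max_matching X M"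
  shows "u \<in> \<Union>M \<or> v \<in> \<Union>M"
  using assms
proof (induction arbitrary: M rule: rtrancl_induct)
  case base then show ?case by simp
next
  case (step y z)
  have yz: "y \<in> missable X" "z \<in> missable X" "{y, z} \<in> E"
    using step.hyps(2) by (auto simp: missable_links_def)
  have adj: "z \<in> \<Union>N \<or> y \<in> \<Union>N" if "max_matching X N" for N
    using max_matching_no_augment[OF that yz(3)] yz by (auto simp: missable_def)
  show ?case
  proof (cases "u = y")
    case True then show ?thesis using adj step.prems by blast
  next
    case False
    show ?thesis
      by (rule missed_trans[OF yz(1) _ _ step.prems])
        (use False step.IH adj in blast)+
  qed
qed

section \<open>Vertex deletion and Gallai-Edmonds barriers\<close>

lemma matching_number_remove:
  assumes "a \<notin> missable X" "a \<in> X"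
  shows "Suc (matching_number (X - {a})) = matching_number X"
proof (rule antisym)
  obtain K where K: "max_matching (X - {a}) K" using ex_max_matching by blast
  then have mK: "matching X K" using matching_mono by (auto simp: max_matching_def)
  have "a \<notin> \<Union>K" using K Union_matching_subset by (fastforce simp: max_matching_def)
  then have "card K \<noteq> matching_number X"
    using assms mK by (auto simp: missable_def max_matching_def)
  then show "Suc (matching_number (X - {a})) \<le> matching_number X"
    using card_le_matching_number[OF mK] K by (auto simp: max_matching_def)
  obtain M where M: "max_matching X M" using ex_max_matching by blast
  then have mM: "matching X M" and cM: "card M = matching_number X" by (auto simp: max_matching_def)
  have "a \<in> \<Union>M" using assms M by (auto simp: missable_def)
  then obtain e where e: "e \<in> M" "a \<in> e" by auto
  have "\<Union>(M - {e}) \<subseteq> X - {a}"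
    using matching_unique[OF mM e(1)] e(2) Union_matching_subset[OF mM] by blast
  then have "matching (X - {a}) (M - {e})" by (intro matching_subset[OF mM]) auto
  from card_le_matching_number[OF this] show "matching_number X \<le> Suc (matching_number (X - {a}))"
    using e finite_matching[OF mM] cM by (metis Suc_le_mono card_Suc_Diff1)
qed

text \<open>Let \<open>K\<close> be a maximum matching of \<open>X - {a}\<close> missing some
  \<open>y\<close> outside \<open>missable X\<close>, as close as possible to a maximum matching
  \<open>M\<close> of \<open>X\<close> missing \<open>x\<close>. It has one edge fewer than
  \<open>M\<close>. Exchanges show that it covers all vertices of \<open>M\<close> except
  \<open>a\<close> and \<open>y\<close>; by counting it covers no others, so it misses
  \<open>x\<close>. Adding \<open>{a, x}\<close> gives a maximum matching of \<open>X\<close> that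
  misses \<open>y\<close>.\<close>

lemma missable_remove:
  assumes a: "a \<notin> missable X" "a \<in> X" and x: "x \<in> missable X" "{a, x} \<in> E"
  shows "missable (X - {a}) \<subseteq> missable X"
proof
  fix y assume "y \<in> missable (X - {a})"
  then obtain K0 where y: "y \<in> X" "y \<noteq> a" and K0: "max_matching (X - {a}) K0" "y \<notin> \<Union>K0"
    by (auto simp: missable_def)
  show "y \<in> missable X"
  proof (rule ccontr)
    assume ny: "y \<notin> missable X"
    obtain M where M: "max_matching X M" "x \<notin> \<Union>M" using x by (auto simp: missable_def)
    let ?P = "\<lambda>K. max_matching (X - {a}) K \<and> y \<notin> \<Union>K"
    have "?P K0" using K0 by simp
    then obtain K where K: "?P K" and best: "\<And>K'. ?P K' \<Longrightarrow> card (K' \<inter> M) \<le> card (K \<inter> M)"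
      by (rule ex_closest_matching[where X = X])
        (auto simp: max_matching_def intro: matching_mono)
    have mM: "matching X M" and mKa: "matching (X - {a}) K" and mK: "matching X K"
      using M K by (auto simp: max_matching_def intro: matching_mono)
    have card: "Suc (card K) = card M"
      using matching_number_remove[OF a] M K by (auto simp: max_matching_def)
    have naK: "a \<notin> \<Union>K" using Union_matching_subset[OF mKa] by auto
    \<comment> \<open>An edge added to \<open>K\<close> makes it maximum in \<open>X\<close>, and
      then it must cover both \<open>a\<close> and \<open>y\<close>. Only the edge
      \<open>{a, y}\<close> could achieve this.\<close>
    have noaug: False
      if "{z, p} \<in> E" "z \<in> X" "p \<in> X" "z \<notin> \<Union>K" "p \<notin> \<Union>K" "\<not> (a \<in> {z, p} \<and> y \<in> {z, p})" for z p
    proof -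
      have "max_matching X (insert {z, p} K)"
        using matching_insert[OF mK that(1-5)] card M by (auto simp: max_matching_def)
      moreover have "a \<notin> \<Union>(insert {z, p} K) \<or> y \<notin> \<Union>(insert {z, p} K)"
        using that(6) naK K by auto
      ultimately show False using a ny y by (auto simp: missable_def)
    qed
    have "\<Union>M - {a, y} \<subseteq> \<Union>K"
    proof
      fix z assume z: "z \<in> \<Union>M - {a, y}"
      show "z \<in> \<Union>K"
      proof (rule ccontr)
        assume nz: "z \<notin> \<Union>K"
        obtain p where p: "{z, p} \<in> M" using matching_partner[OF mM] z by blast
        then have pE: "{z, p} \<in> E" "z \<in> X" "p \<in> X" using mM by (auto simp: matching_def)
        have "p \<in> \<Union>K" using noaug[OF pE nz] z y by blast
        then obtain q where q: "{p, q} \<in> K" using matching_partner[OF mK] by blast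
        define L where "L = insert {z, p} (K - {{p, q}})"
        note ex = exchange[OF mK mM p q nz, folded L_def]
        have "a \<notin> \<Union>L" unfolding ex(4) using naK z by auto
        with Union_matching_subset[OF ex(1)] have "\<Union>L \<subseteq> X - {a}" by (simp add: subset_Diff_insert)
        then have "matching (X - {a}) L"
          by (rule matching_subset[OF ex(1) order_refl])
        moreover have "y \<notin> \<Union>L" unfolding ex(4) using K z by auto
        ultimately have "?P L" using ex(2) K by (simp add: max_matching_def)
        from best[OF this] ex(3) show False by linarith
      qed
    qed
    then have sub: "\<Union>M \<subseteq> insert a (insert y (\<Union>K))" by blast
    have fin: "finite (insert a (insert y (\<Union>K)))" using finite_Union_matching[OF mK] by simp
    have "card (insert a (insert y (\<Union>K))) = card (\<Union>M)"
      using naK K y finite_Union_matching[OF mK] card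
        card_Union_matching[OF mK] card_Union_matching[OF mM] by simp
    then have "\<Union>M = insert a (insert y (\<Union>K))"
      using card_subset_eq[OF fin sub] by simp
    then have "x \<notin> \<Union>K" "x \<noteq> y" "x \<noteq> a" using M(2) by auto
    then show False using noaug[of a x] x a naK y by (auto simp: missable_def)
  qed
qed

text \<open>A weak form of the Gallai--Edmonds structure theorem. Taking \<open>A\<close> maximal makes its role
  independent of the exact neighbourhood of \<open>missable X\<close>, so that the two sets
  \<open>missable (X - A)\<close> and \<open>missable X\<close> need not be shown equal.\<close>

lemma ex_barrier:
  obtains A where "A \<subseteq> X" "matching_number (X - A) + card A = matching_number X"
    "missable (X - A) \<subseteq> missable X"
    "\<And>x y. x \<in> missable (X - A) \<Longrightarrow> y \<in> X - A \<Longrightarrow> {x, y} \<in> E \<Longrightarrow> y \<in> missable (X - A)"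
proof -
  let ?P = "\<lambda>A. A \<subseteq> X \<and> finite A \<and> matching_number (X - A) + card A = matching_number X
    \<and> missable (X - A) \<subseteq> missable X"
  have "?P {}" by simp
  then have "\<exists>A. ?P A \<and> (\<forall>B. ?P B \<longrightarrow> card B \<le> card A)"
    by (intro ex_has_greatest_nat[where k = "{}" and b = "Suc (matching_number X)"]) auto
  then obtain A where A: "?P A" and best: "\<And>B. ?P B \<Longrightarrow> card B \<le> card A" by blast
  show thesis
  proof (rule that[of A])
    fix x y assume xy: "x \<in> missable (X - A)" "y \<in> X - A" "{x, y} \<in> E"
    show "y \<in> missable (X - A)"
    proof (rule ccontr)
      \<comment> \<open>Such a \<open>y\<close> can join \<open>A\<close>: the matching number drops
        by exactly one and no new vertex becomes missable. This contradicts the maximal size of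
        \<open>A\<close>.\<close>
      assume ny: "y \<notin> missable (X - A)"
      have eq: "X - A - {y} = X - insert y A" by auto
      have "missable (X - insert y A) \<subseteq> missable (X - A)"
        using missable_remove[OF ny xy(2) xy(1)] xy(3) unfolding eq by (simp add: insert_commute)
      moreover have "Suc (matching_number (X - insert y A)) = matching_number (X - A)"
        using matching_number_remove[OF ny xy(2)] unfolding eq .
      ultimately have "?P (insert y A)" using A xy(2) by auto
      from best[OF this] show False using A xy(2) by auto
    qed
  qed (use A in auto)
qed

text \<open>At most \<open>card A\<close> edges of \<open>M\<close> meet \<open>A\<close>, one for
  each vertex of \<open>A\<close>, and at most \<open>matching_number (X - A)\<close> avoid it.
  These bounds add up to \<open>card M\<close>, so both are attained.\<close>

lemma max_matching_barrier:
  assumes A: "finite A" "A \<subseteq> X" "matching_number (X - A) + card A = matching_number X"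
    and M: "max_matching X M"
  shows "max_matching (X - A) {e \<in> M. e \<subseteq> X - A}" "card {e \<in> M. \<not> e \<subseteq> X - A} = card A"
proof -
  have mM: "matching X M" and cM: "card M = matching_number X" and fM: "finite M"
    using M finite_matching by (auto simp: max_matching_def)
  have "{e \<in> M. \<not> e \<subseteq> X - A} \<subseteq> (\<Union>a\<in>A. {e \<in> M. a \<in> e})"
    using mM by (auto simp: matching_def)
  then have "card {e \<in> M. \<not> e \<subseteq> X - A} \<le> card (\<Union>a\<in>A. {e \<in> M. a \<in> e})"
    using A(1) fM by (intro card_mono) auto
  also have "\<dots> \<le> (\<Sum>a\<in>A. card {e \<in> M. a \<in> e})" by (rule card_UN_le[OF A(1)])
  also have "\<dots> \<le> (\<Sum>a\<in>A. 1)"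
  proof (rule sum_mono)
    fix a
    have "e = f" if "e \<in> M" "f \<in> M" "a \<in> e" "a \<in> f" for e f
      using matching_unique[OF mM] that by blast
    then show "card {e \<in> M. a \<in> e} \<le> 1"
      using fM by (auto simp: card_le_Suc0_iff_eq)
  qed
  finally have le: "card {e \<in> M. \<not> e \<subseteq> X - A} \<le> card A" by simp
  have m: "matching (X - A) {e \<in> M. e \<subseteq> X - A}"
    by (rule matching_subset[OF mM]) auto
  have "card M = card {e \<in> M. e \<subseteq> X - A} + card {e \<in> M. \<not> e \<subseteq> X - A}"
    using fM by (subst card_Un_disjoint[symmetric]) (auto intro: arg_cong[where f = card])
  then show "max_matching (X - A) {e \<in> M. e \<subseteq> X - A}" "card {e \<in> M. \<not> e \<subseteq> X - A} = card A"
    using le card_le_matching_number[OF m] A(3) cM m by (auto simp: max_matching_def)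
qed

end

section \<open>Independence systems and partitions into independent sets\<close>

locale independence_system =
  fixes V :: "'a set" and F :: "'a set set"
  assumes finite_ground: "finite V"
    and indep_subset: "S \<in> F \<Longrightarrow> S \<subseteq> V"
    and indep_mono: "S \<in> F \<Longrightarrow> T \<subseteq> S \<Longrightarrow> T \<noteq> {} \<Longrightarrow> T \<in> F"
    and indep_singleton: "x \<in> V \<Longrightarrow> {x} \<in> F"
begin

abbreviation pairs :: "'a set set" where
  "pairs \<equiv> {e \<in> F. card e = 2}"

sublocale matching_graph V pairs
  by unfold_locales (use finite_ground indep_subset in auto)

definition indep_partition :: "'a set \<Rightarrow> 'a set set \<Rightarrow> bool" where
  "indep_partition X P \<longleftrightarrow> partition_on X P \<and> P \<subseteq> F"

definition matching_partition :: "'a set \<Rightarrow> 'a set set \<Rightarrow> 'a set set" where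
  "matching_partition X M = M \<union> (\<lambda>x. {x}) ` (X - \<Union>M)"

lemma pairI: "S \<in> F \<Longrightarrow> x \<in> S \<Longrightarrow> y \<in> S \<Longrightarrow> x \<noteq> y \<Longrightarrow> {x, y} \<in> pairs"
  using indep_mono[of S "{x, y}"] by auto

lemma indep_partition_subset_ground: "indep_partition X P \<Longrightarrow> X \<subseteq> V"
  unfolding indep_partition_def partition_on_def using indep_subset by blast

lemma finite_indep_partition: "indep_partition X P \<Longrightarrow> finite P"
  using finite_elements finite_subset[OF indep_partition_subset_ground finite_ground]
  by (auto simp: indep_partition_def)

lemma indep_partition_Un:
  assumes "indep_partition X P" "indep_partition Y Q" "X \<inter> Y = {}"
  shows "indep_partition (X \<union> Y) (P \<union> Q)"
proof -
  have cross: "S \<inter> S' = {}" if "S \<in> P" "S' \<in> Q" for S S'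
    using that assms unfolding indep_partition_def partition_on_def by blast
  have d: "disjoint P" "disjoint Q"
    using assms by (auto simp: indep_partition_def partition_on_def)
  have "disjoint (P \<union> Q)"
  proof (rule disjointI)
    fix a b assume "a \<in> P \<union> Q" "b \<in> P \<union> Q" "a \<noteq> b"
    then show "a \<inter> b = {}"
      using cross[of a b] cross[of b a] disjointD[OF d(1), of a b] disjointD[OF d(2), of a b]
      by auto
  qed
  then show ?thesis
    using assms unfolding indep_partition_def partition_on_def by simp
qed

lemma card_part_pos:
  assumes "indep_partition X P" "S \<in> P" shows "0 < card S"
proof -
  have "finite S" "S \<noteq> {}"
    using assms indep_subset finite_ground
    by (auto simp: indep_partition_def partition_on_def intro: finite_subset)
  then show ?thesis by (simp add: card_gt_0_iff)
qed

lemma indep_partition_part: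
  assumes "indep_partition X P" "Q \<subseteq> P" "\<Union>Q = Y"
  shows "indep_partition Y Q"
  using assms unfolding indep_partition_def partition_on_def by (auto intro: pairwise_subset)

text \<open>Each edge of \<open>M\<close> saves one class against the partition into
  singletons.\<close>

lemma indep_partition_matching:
  assumes "matching X M" "X \<subseteq> V"
  shows "indep_partition X (matching_partition X M)"
    "card (matching_partition X M) + card M \<le> card X"
proof -
  have M: "M \<subseteq> F" "disjoint M" "\<Union>M \<subseteq> X" using assms unfolding matching_def by auto
  have "{} \<notin> M" using assms(1) edgeD unfolding matching_def by fastforce
  then show "indep_partition X (matching_partition X M)"
    using M assms(2) indep_singleton
    unfolding indep_partition_def partition_on_def matching_partition_def disjoint_def by auto
  have "card (matching_partition X M) \<le> card M + card ((\<lambda>x. {x}) ` (X - \<Union>M))"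
    unfolding matching_partition_def by (rule card_Un_le)
  also have "card ((\<lambda>x. {x}) ` (X - \<Union>M)) \<le> card (X - \<Union>M)"
    using finite_subset[OF assms(2) finite_ground] by (intro card_image_le) auto
  also have "card (X - \<Union>M) = card X - 2 * card M"
    using card_Diff_subset[OF finite_Union_matching[OF assms(1)] M(3)] card_Union_matching[OF assms(1)]
    by simp
  finally show "card (matching_partition X M) + card M \<le> card X"
    using card_mono[OF finite_subset[OF assms(2) finite_ground] M(3)] card_Union_matching[OF assms(1)]
    by simp
qed

lemma card_eq_sum_indep_partition:
  assumes "indep_partition X P" shows "card X = (\<Sum>S\<in>P. card S)"
proof -
  have "card (\<Union>P) = sum card P"
    using assms finite_ground indep_subset unfolding indep_partition_def partition_on_def
    by (intro card_Union_disjoint) (auto intro: finite_subset)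
  then show ?thesis using assms by (auto simp: indep_partition_def partition_on_def)
qed

end

section \<open>Partitions with fewest classes and, among these, fewest singletons\<close>

locale optimal_partition = independence_system +
  fixes P :: "'a set set" and k :: nat
  assumes P: "indep_partition V P" "card P = k"
    and k_min: "indep_partition V Q \<Longrightarrow> k \<le> card Q"
    and singletons_min: "indep_partition V Q \<Longrightarrow> card Q = k \<Longrightarrow>
      card {S \<in> P. card S = 1} \<le> card {S \<in> Q. card S = 1}"
begin

definition B :: "'a set set" where "B = {S \<in> P. card S \<ge> 3}"
definition W :: "'a set" where "W = V - \<Union>B"
definition T :: "'a set set" where "T = {S \<in> P. card S = 2}"

lemma finite_W: "finite W" using finite_ground by (auto simp: W_def)

lemma W_subset: "W \<subseteq> V" by (auto simp: W_def)

lemma P_disjoint: "S \<in> P \<Longrightarrow> S' \<in> P \<Longrightarrow> S \<noteq> S' \<Longrightarrow> S \<inter> S' = {}"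
  using P by (auto simp: indep_partition_def partition_on_def disjoint_def)

lemma B_partition: "indep_partition (V - W) B"
proof (rule indep_partition_part[OF P(1)])
  show "B \<subseteq> P" by (auto simp: B_def)
  have "\<Union>B \<subseteq> V" using P(1) by (auto simp: B_def indep_partition_def partition_on_def)
  then show "\<Union>B = V - W" by (auto simp: W_def)
qed

text \<open>This turns the number of singletons of \<open>P\<close> into the number of vertices of
  \<open>W\<close> missed by a matching.\<close>

lemma singletons_W: "{S \<in> P. card S = 1} = (\<lambda>x. {x}) ` (W - \<Union>T)"
proof (intro equalityI subsetI)
  fix S assume S: "S \<in> {S \<in> P. card S = 1}"
  then obtain x where x: "S = {x}" by (auto simp: card_1_singleton_iff)
  have "x \<in> V" using S x P(1) by (auto simp: indep_partition_def partition_on_def)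
  moreover have "x \<notin> S'" if "S' \<in> P" "S' \<noteq> S" for S' using P_disjoint[of S S'] S x that by auto
  ultimately show "S \<in> (\<lambda>x. {x}) ` (W - \<Union>T)"
    using x by (fastforce simp: W_def B_def T_def)
next
  fix S assume "S \<in> (\<lambda>x. {x}) ` (W - \<Union>T)"
  then obtain x where x: "S = {x}" "x \<in> V" "x \<notin> \<Union>B" "x \<notin> \<Union>T" by (auto simp: W_def)
  then obtain S' where S': "S' \<in> P" "x \<in> S'" using P(1) by (auto simp: indep_partition_def partition_on_def)
  then have "\<not> card S' \<ge> 3" "card S' \<noteq> 2" using x by (auto simp: B_def T_def)
  moreover have "card S' \<noteq> 0" using card_part_pos[OF P(1) S'(1)] by simp
  ultimately have "card S' = 1" by linarith
  then show "S \<in> {S \<in> P. card S = 1}" using S' x by (auto simp: card_1_singleton_iff)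
qed

lemma T_matching: "matching W T"
proof -
  have "S \<subseteq> W" if "S \<in> T" for S
    using that P_disjoint P(1) by (fastforce simp: T_def B_def W_def indep_partition_def partition_on_def)
  then show ?thesis
    using P(1) by (auto simp: matching_def T_def indep_partition_def partition_on_def
        intro: pairwise_subset)
qed

lemma card_singletons: "card {S \<in> P. card S = 1} = card (W - \<Union>T)"
  unfolding singletons_W by (rule card_image) auto

text \<open>The singletons number \<open>card W - 2 * card T\<close>, and together with
  \<open>B\<close> and \<open>T\<close> they make up \<open>P\<close>.\<close>

lemma k_eq: "k + card T = card B + card W"
proof -
  have fP: "finite P" using finite_indep_partition P by blast
  have pos: "card S \<noteq> 0" if "S \<in> P" for S
    using card_part_pos[OF P(1) that] by simp
  have "P = B \<union> (T \<union> {S \<in> P. card S = 1})"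
    using pos by (force simp: B_def T_def)
  then have "card P = card (B \<union> (T \<union> {S \<in> P. card S = 1}))" by (rule arg_cong)
  moreover have "card (B \<union> (T \<union> {S \<in> P. card S = 1})) = card B + (card T + card {S \<in> P. card S = 1})"
    using fP by (subst card_Un_disjoint | force simp: B_def T_def)+
  moreover have "card (W - \<Union>T) = card W - 2 * card T"
    using card_Diff_subset[OF finite_Union_matching Union_matching_subset] card_Union_matching T_matching
    by metis
  moreover have "2 * card T \<le> card W"
    using card_mono[OF finite_W Union_matching_subset] card_Union_matching T_matching by metis
  ultimately show ?thesis using card_singletons P(2) by linarith
qed

text \<open>Keeping \<open>B\<close> and splitting \<open>W\<close> according to \<open>M\<close>
  partitions \<open>V\<close>. Together with \<open>k_eq\<close> this bounds \<open>card M\<close>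
  by \<open>card T\<close>, so \<open>T\<close> is a maximum matching.\<close>

lemma k_le:
  assumes "matching W M" shows "k + card M \<le> card B + card W"
proof -
  have "indep_partition ((V - W) \<union> W) (B \<union> matching_partition W M)"
    using indep_partition_Un[OF B_partition indep_partition_matching(1)[OF assms W_subset]] by blast
  then have "k \<le> card (B \<union> matching_partition W M)"
    using k_min W_subset by (simp add: Un_absorb2)
  also have "\<dots> \<le> card B + card (matching_partition W M)" by (rule card_Un_le)
  finally show ?thesis using indep_partition_matching(2)[OF assms W_subset] by linarith
qed

lemma T_max: "max_matching W T"
proof -
  obtain M where M: "max_matching W M" using ex_max_matching by blast
  then have "card M \<le> card T" using k_le[of M] k_eq by (simp add: max_matching_def)
  then show ?thesis
    using card_le_matching_number[OF T_matching] M T_matching by (simp add: max_matching_def)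
qed

lemma k_matching_number: "k + matching_number W = card B + card W"
  using k_eq T_max by (simp add: max_matching_def)

text \<open>Otherwise \<open>x\<close> could be paired with an element \<open>y\<close> of a class with at least three elements,
  which would leave as many classes but fewer singletons.\<close>

lemma missable_neighbour:
  assumes x: "x \<in> missable W" and xy: "{x, y} \<in> pairs"
  shows "y \<in> W"
proof (rule ccontr)
  assume "y \<notin> W"
  have "y \<in> V" using xy indep_subset by auto
  with \<open>y \<notin> W\<close> obtain S where S: "S \<in> B" "y \<in> S" by (auto simp: W_def)
  obtain M where M: "max_matching W M" "x \<notin> \<Union>M" "x \<in> W" using x by (auto simp: missable_def)
  let ?S = "S - {y}" and ?M = "matching_partition (W - {x}) M"
  have mM: "matching W M" "matching (W - {x}) M"
    using M matching_subset[of W M M "W - {x}"] Union_matching_subset[of W M]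
    by (auto simp: max_matching_def)
  have fS: "finite S" "card S \<ge> 3" "S \<in> F" "S \<subseteq> V - W"
    using S P indep_subset finite_ground B_partition
    by (auto simp: B_def indep_partition_def partition_on_def intro: finite_subset)
  \<comment> \<open>The size of \<open>S\<close> matters here: what remains of it is not a
    singleton.\<close>
  have cS: "card ?S \<ge> 2" using fS S by simp
  \<comment> \<open>\<open>y\<close> moves from \<open>S\<close> to a class with \<open>x\<close>;
    the rest of \<open>W\<close> is split according to \<open>M\<close>, which misses
    \<open>x\<close>.\<close>
  define Q where "Q = (B - {S}) \<union> ({?S, {x, y}} \<union> ?M)"
  have M': "indep_partition (W - {x}) ?M" "card ?M + card M \<le> card W - 1"
    using indep_partition_matching[OF mM(2)] W_subset M(3) finite_W by auto
  have ne: "?S \<noteq> {}" using cS by (metis card.empty not_numeral_le_zero)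
  then have "?S \<in> F" using indep_mono fS by blast
  have yV: "y \<notin> W" "x \<notin> S" using \<open>y \<notin> W\<close> fS M(3) by auto
  have "indep_partition (?S \<union> {x, y}) {?S, {x, y}}"
    using \<open>?S \<in> F\<close> xy ne yV unfolding indep_partition_def partition_on_def disjoint_def by auto
  then have 1: "indep_partition (?S \<union> {x, y} \<union> (W - {x})) ({?S, {x, y}} \<union> ?M)"
    by (rule indep_partition_Un[OF _ M'(1)]) (use yV fS(4) in auto)
  have "\<Union>(B - {S}) = (V - W) - S"
    using B_partition S unfolding indep_partition_def partition_on_def disjoint_def by blast
  then have "indep_partition ((V - W) - S) (B - {S})"
    by (intro indep_partition_part[OF B_partition]) auto
  then have "indep_partition (((V - W) - S) \<union> (?S \<union> {x, y} \<union> (W - {x}))) Q"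
    unfolding Q_def by (rule indep_partition_Un[OF _ 1]) (use S yV M(3) in auto)
  moreover have "((V - W) - S) \<union> (?S \<union> {x, y} \<union> (W - {x})) = V"
    using fS(4) W_subset M(3) S(2) by auto
  ultimately have Q: "indep_partition V Q" by simp
  have "card Q \<le> card (B - {S}) + card ({?S, {x, y}} \<union> ?M)" unfolding Q_def by (rule card_Un_le)
  also have "card ({?S, {x, y}} \<union> ?M) \<le> card {?S, {x, y}} + card ?M" by (rule card_Un_le)
  also have "card {?S, {x, y}} \<le> 2" by (simp add: card_insert_if)
  finally have "card Q \<le> card (B - {S}) + (2 + card ?M)" by simp
  moreover have "card B = Suc (card (B - {S}))"
    using S finite_indep_partition[OF B_partition] by (metis card_Suc_Diff1)
  moreover have "card W > 0" using M(3) finite_W by (auto simp: card_gt_0_iff)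
  \<comment> \<open>In total \<open>card B - 1 + 2 + card W - 1 - card M\<close>, which is
    \<open>k\<close>.\<close>
  ultimately have "card Q \<le> k"
    using M'(2) k_matching_number M(1) by (simp add: max_matching_def)
  then have ck: "card Q = k" using k_min[OF Q] by simp
  have "{S \<in> Q. card S = 1} \<subseteq> (\<lambda>x. {x}) ` (W - {x} - \<Union>M)"
  proof
    fix Z assume Z: "Z \<in> {S \<in> Q. card S = 1}"
    have "card {x, y} = 2" using xy by auto
    then have "Z \<in> ?M" using Z cS unfolding Q_def B_def by auto
    moreover have "Z \<notin> M" using Z edgeD mM(1) by (fastforce simp: matching_def)
    ultimately show "Z \<in> (\<lambda>x. {x}) ` (W - {x} - \<Union>M)" by (simp add: matching_partition_def)
  qed
  then have "card {S \<in> Q. card S = 1} \<le> card ((\<lambda>x. {x}) ` (W - {x} - \<Union>M))"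
    using finite_W by (intro card_mono) auto
  also have "\<dots> \<le> card (W - {x} - \<Union>M)" using finite_W by (intro card_image_le) auto
  \<comment> \<open>Strict because \<open>x\<close> is itself missed by \<open>M\<close>.\<close>
  also have "\<dots> < card (W - \<Union>M)" using M finite_W by (intro psubset_card_mono) auto
  also have "card (W - \<Union>M) = card W - 2 * card M"
    using card_Diff_subset[OF finite_Union_matching Union_matching_subset] card_Union_matching mM(1)
    by metis
  also have "\<dots> = card (W - \<Union>T)"
    using card_Diff_subset[OF finite_Union_matching Union_matching_subset] card_Union_matching T_matching
      M(1) T_max unfolding max_matching_def by metis
  finally show False using singletons_min[OF Q ck] card_singletons by simp
qed

text \<open>Let \<open>D = missable (W - A)\<close>. No independent set of \<open>V - A\<close> meets two components of \<open>D\<close> or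
  leaves \<open>D\<close>, and on each component \<open>R\<close> has at least as many classes as a largest matching leaves
  (otherwise \<open>P\<close> could be improved there). So \<open>D\<close> may be repartitioned by the largest matching \<open>T\<close>,
  whose edges at \<open>A\<close> absorb \<open>A\<close> without a new class.\<close>

lemma card_le_of_barrier:
  assumes A: "A \<subseteq> W" "matching_number (W - A) + card A = matching_number W"
      "missable (W - A) \<subseteq> missable W"
    and closed: "\<And>x y. x \<in> missable (W - A) \<Longrightarrow> y \<in> W - A \<Longrightarrow> {x, y} \<in> pairs \<Longrightarrow>
      y \<in> missable (W - A)"
    and R: "indep_partition (V - A) R"
  shows "k \<le> card R"
proof -
  define D where "D = missable (W - A)"
  \<comment> \<open>The closure is reflexive on the whole type; restricted to \<open>D\<close> it is
    an equivalence whose classes are the components of \<open>D\<close>.\<close>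
  define r where "r = {(x, y). x \<in> D \<and> y \<in> D \<and> (x, y) \<in> (missable_links (W - A))\<^sup>*}"
  have DW: "D \<subseteq> W - A" by (auto simp: D_def missable_def)
  have fA: "finite A" and fD: "finite D" using A(1) DW finite_W finite_subset by blast+
  note fR = finite_indep_partition[OF R]
  have "sym (missable_links (W - A))" by (auto simp: sym_def missable_links_def insert_commute)
  then have "sym ((missable_links (W - A))\<^sup>*)" by (rule sym_rtrancl)
  then have "equiv D r"
    by (intro equivI refl_onI symI transI) (auto simp: r_def dest: symD)
  then have part: "partition_on D (D // r)" by (rule partition_on_quotient)
  have fC: "finite (D // r)" using finite_elements[OF fD part] .
  \<comment> \<open>Neighbours of \<open>D\<close> stay in \<open>W\<close> by
    \<open>missable_neighbour\<close>, and those outside \<open>A\<close> stay in \<open>D\<close>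
    by \<open>closed\<close>.\<close>
  have same_class: "y \<in> C" if "C \<in> D // r" "x \<in> C" "y \<in> V - A" "{x, y} \<in> pairs" for C x y
  proof -
    have "x \<in> D" using part that(1,2) by (auto simp: partition_on_def)
    then have "y \<in> W" using missable_neighbour that(4) A(3) by (auto simp: D_def)
    then have "y \<in> D" using closed \<open>x \<in> D\<close> that(3,4) by (auto simp: D_def)
    then have "(x, y) \<in> r"
      using \<open>x \<in> D\<close> that(4) by (auto simp: r_def D_def missable_links_def)
    then show ?thesis
      using that(1,2) \<open>equiv D r\<close> by (meson in_quotient_imp_closed)
  qed
  \<comment> \<open>Any two elements of an independent set form an edge, so it is a clique and
    cannot spread over several components.\<close>
  have class_or_disjoint: "S \<subseteq> C" if "C \<in> D // r" "S \<in> F" "S \<subseteq> V - A" "S \<inter> C \<noteq> {}" for C S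
  proof
    fix y assume y: "y \<in> S"
    obtain x where x: "x \<in> S" "x \<in> C" using \<open>S \<inter> C \<noteq> {}\<close> by auto
    show "y \<in> C"
    proof (cases "y = x")
      case False
      then have "{x, y} \<in> pairs" using pairI[OF that(2) x(1) y] by auto
      then show ?thesis using same_class[OF that(1) x(2)] y that(3) by auto
    qed (use x in simp)
  qed
  have class_sum: "card {S \<in> Q. S \<subseteq> D} = (\<Sum>C\<in>D // r. card {S \<in> Q. S \<subseteq> C})"
    if Q: "Q \<subseteq> F" "finite Q" "{} \<notin> Q" for Q
  proof -
    have "{S \<in> Q. S \<subseteq> D} = (\<Union>C\<in>D // r. {S \<in> Q. S \<subseteq> C})"
    proof (intro equalityI subsetI)
      fix S assume S: "S \<in> {S \<in> Q. S \<subseteq> D}"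
      then obtain x where x: "x \<in> S" "x \<in> D" using Q(3) by (metis (mono_tags, lifting) all_not_in_conv mem_Collect_eq subsetD)
      then obtain C where C: "C \<in> D // r" "x \<in> C" using part by (auto simp: partition_on_def)
      have "S \<subseteq> C" by (rule class_or_disjoint[OF C(1)]) (use S x C Q(1) DW W_subset in auto)
      then show "S \<in> (\<Union>C\<in>D // r. {S \<in> Q. S \<subseteq> C})" using S C by auto
    next
      fix S assume "S \<in> (\<Union>C\<in>D // r. {S \<in> Q. S \<subseteq> C})"
      then show "S \<in> {S \<in> Q. S \<subseteq> D}" using part by (auto simp: partition_on_def)
    qed
    moreover have "{S \<in> Q. S \<subseteq> C} \<inter> {S \<in> Q. S \<subseteq> C'} = {}"
      if CC: "C \<in> D // r" "C' \<in> D // r" "C \<noteq> C'" for C C'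
    proof -
      have "C \<inter> C' = {}" using part CC by (auto simp: partition_on_def disjoint_def)
      then show ?thesis using Q(3) by (auto dest: subset_empty[THEN iffD1] intro: ccontr) (metis Int_greatest subset_empty)
    qed
    ultimately show ?thesis using fC Q(2) by (simp add: card_UN_disjoint)
  qed
  have mT: "matching W T" using T_matching .
  define K where "K = {e \<in> T. e \<subseteq> W - A}"
  have K: "max_matching (W - A) K" and cA: "card {e \<in> T. \<not> e \<subseteq> W - A} = card A"
    unfolding K_def using max_matching_barrier[OF fA A(1,2) T_max] by auto
  have class_covered: "C - {x} \<subseteq> \<Union>M"
    if "C \<in> D // r" "x \<in> C" "x \<notin> \<Union>M" "max_matching (W - A) M" for C x M
  proof
    fix y assume y: "y \<in> C - {x}"
    then have "(x, y) \<in> r" using that(1,2) \<open>equiv D r\<close> by (auto simp: in_quotient_imp_in_rel)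
    then show "y \<in> \<Union>M"
      using linked_not_both_missed[of x y "W - A" M] that(3,4) y by (auto simp: r_def)
  qed
  have inside: "e \<subseteq> C" if "C \<in> D // r" "matching (W - A) M" "e \<in> M" "e \<inter> C \<noteq> {}" for C M e
    using class_or_disjoint[OF that(1) _ _ that(4)] that(2,3) W_subset by (auto simp: matching_def)
  \<comment> \<open>The classes of \<open>R\<close> inside \<open>C\<close> are spliced into the
    partition built from a maximum matching \<open>N\<close> of \<open>W\<close> missing a vertex
    \<open>x\<close> of \<open>C\<close>. Minimality of \<open>k\<close> bounds
    \<open>card C\<close> by their number plus the number of edges of \<open>N\<close> inside
    \<open>C\<close>, and \<open>T\<close> has at least as many edges there as
    \<open>N\<close>.\<close>
  have class_bound: "card C \<le> card {S \<in> R. S \<subseteq> C} + card {e \<in> T. e \<subseteq> C}" if C: "C \<in> D // r" for C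
  proof -
    have CD: "C \<subseteq> D" and Cne: "C \<noteq> {}" using part C by (auto simp: partition_on_def)
    then obtain x where x: "x \<in> C" by auto
    have fin: "finite C" using CD fD finite_subset by blast
    obtain N where N: "max_matching W N" "x \<notin> \<Union>N"
      using x CD A(3) by (auto simp: D_def missable_def)
    then have mN: "matching W N" by (simp add: max_matching_def)
    define N' where "N' = {e \<in> N. e \<subseteq> W - A}"
    have N': "max_matching (W - A) N'"
      unfolding N'_def using max_matching_barrier(1)[OF fA A(1,2) N(1)] .
    have xN': "x \<notin> \<Union>N'" using N(2) by (auto simp: N'_def)
    note cov = class_covered[OF C x xN' N']
    \<comment> \<open>By Gallai's lemma the edges of \<open>N\<close> avoiding \<open>A\<close>
      already cover \<open>C - {x}\<close>, and they stay in \<open>C\<close>; so no edge of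
      \<open>N\<close> joins \<open>C\<close> to \<open>A\<close> either.\<close>
    have NC: "e \<subseteq> C" if "e \<in> N" "e \<inter> C \<noteq> {}" for e
    proof -
      obtain y where y: "y \<in> e" "y \<in> C" using \<open>e \<inter> C \<noteq> {}\<close> by auto
      then have "y \<noteq> x" using N(2) that by auto
      then obtain f where f: "f \<in> N'" "y \<in> f" using cov y by auto
      then have "f = e" using matching_unique[OF mN _ that(1) f(2) y(1)] by (auto simp: N'_def)
      then show ?thesis using inside[OF C _ f(1)] N' that by (auto simp: max_matching_def)
    qed
    let ?NC = "{e \<in> N. e \<subseteq> C}" and ?NO = "{e \<in> N. \<not> e \<subseteq> C}"
    have "matching W ?NC" by (rule matching_subset[OF mN]) (use CD DW in auto)
    moreover have "\<Union>?NC \<subseteq> C - {x}" using N(2) by auto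
    ultimately have nc: "2 * card ?NC \<le> card C - 1"
      using card_Union_matching card_mono[of "C - {x}" "\<Union>?NC"] fin x by simp
    have tc: "card C - 1 \<le> 2 * card {e \<in> T. e \<subseteq> C}"
    proof -
      have eq: "{e \<in> T. e \<subseteq> C} = {e \<in> K. e \<inter> C \<noteq> {}}"
      proof (intro equalityI subsetI)
        fix e assume e: "e \<in> {e \<in> T. e \<subseteq> C}"
        then have "e \<noteq> {}" using edgeD mT by (fastforce simp: matching_def)
        then show "e \<in> {e \<in> K. e \<inter> C \<noteq> {}}" using e CD DW by (auto simp: K_def)
      next
        fix e assume e: "e \<in> {e \<in> K. e \<inter> C \<noteq> {}}"
        then show "e \<in> {e \<in> T. e \<subseteq> C}"
          using inside[OF C, of K e] K by (auto simp: max_matching_def K_def)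
      qed
      \<comment> \<open>For \<open>z\<close> take the vertex of \<open>C\<close> missed by
        \<open>K\<close>, or any vertex if there is none.\<close>
      obtain z where "C - {z} \<subseteq> \<Union>K"
        using class_covered[OF C _ _ K] x by blast
      moreover have "C \<inter> \<Union>K \<subseteq> \<Union>{e \<in> K. e \<inter> C \<noteq> {}}" by auto
      ultimately have "C - {z} \<subseteq> \<Union>{e \<in> T. e \<subseteq> C}" unfolding eq by auto
      moreover have "matching W {e \<in> T. e \<subseteq> C}"
        by (rule matching_subset[OF mT]) (use CD DW in auto)
      ultimately have "card (C - {z}) \<le> 2 * card {e \<in> T. e \<subseteq> C}"
        using card_Union_matching card_mono finite_Union_matching by metis
      then show ?thesis using fin by (simp add: card_Diff_singleton_if split: if_splits)
    qed
    let ?R = "{S \<in> R. S \<subseteq> C}"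
    have "C \<subseteq> V - A" using CD DW W_subset by auto
    have "\<Union>?R = C"
    proof (intro equalityI subsetI)
      fix y assume y: "y \<in> C"
      then have "y \<in> \<Union>R"
        using R \<open>C \<subseteq> V - A\<close> by (auto simp: indep_partition_def partition_on_def)
      then obtain S where S: "S \<in> R" "y \<in> S" by auto
      then have "S \<subseteq> C"
        using class_or_disjoint[OF C, of S] R y by (auto simp: indep_partition_def partition_on_def)
      then show "y \<in> \<Union>?R" using S by auto
    qed auto
    then have RC: "indep_partition C ?R" by (intro indep_partition_part[OF R]) auto
    have WC: "W - C \<subseteq> V" using W_subset by auto
    have "matching (W - C) ?NO"
      by (rule matching_subset[OF mN]) (use NC Union_matching_subset[OF mN] in auto)
    note mp = indep_partition_matching[OF this WC]
    have "indep_partition (C \<union> (W - C)) (?R \<union> matching_partition (W - C) ?NO)"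
      by (rule indep_partition_Un[OF RC mp(1)]) auto
    then have "indep_partition (V - W \<union> (C \<union> (W - C))) (B \<union> (?R \<union> matching_partition (W - C) ?NO))"
      by (rule indep_partition_Un[OF B_partition]) (use CD DW in auto)
    moreover have "V - W \<union> (C \<union> (W - C)) = V" using CD DW W_subset by auto
    ultimately have "k \<le> card (B \<union> (?R \<union> matching_partition (W - C) ?NO))"
      using k_min by simp
    also have "\<dots> \<le> card B + card (?R \<union> matching_partition (W - C) ?NO)" by (rule card_Un_le)
    also have "card (?R \<union> matching_partition (W - C) ?NO) \<le> card ?R + card (matching_partition (W - C) ?NO)"
      by (rule card_Un_le)
    finally have "k + card ?NO \<le> card B + card ?R + card (W - C)" using mp(2) by linarith
    moreover have "card (W - C) + card C = card W"
      using CD DW finite_W fin by (subst card_Un_disjoint[symmetric]) (auto intro: arg_cong[where f = card])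
    moreover have "card ?NC + card ?NO = card N"
      using finite_matching[OF mN] by (subst card_Un_disjoint[symmetric]) (auto intro: arg_cong[where f = card])
    moreover have "k + card N = card B + card W"
      using k_matching_number N(1) by (simp add: max_matching_def)
    ultimately have "card C \<le> card ?R + card ?NC" by linarith
    then show ?thesis using nc tc by linarith
  qed
  have "card D = (\<Sum>C\<in>D // r. card C)"
  proof -
    have "card (\<Union>(D // r)) = sum card (D // r)"
      using part fD by (intro card_Union_disjoint) (auto simp: partition_on_def intro: finite_subset)
    then show ?thesis using part by (simp add: partition_on_def)
  qed
  also have "\<dots> \<le> (\<Sum>C\<in>D // r. card {S \<in> R. S \<subseteq> C} + card {e \<in> T. e \<subseteq> C})"
    by (rule sum_mono) (rule class_bound)
  also have "\<dots> = card {S \<in> R. S \<subseteq> D} + card {e \<in> T. e \<subseteq> D}"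
  proof -
    have "{} \<notin> R" "R \<subseteq> F" using R by (auto simp: indep_partition_def partition_on_def)
    moreover have "{} \<notin> T" "T \<subseteq> F" using mT by (auto simp: matching_def)
    ultimately show ?thesis
      using class_sum fR finite_matching[OF mT] by (simp add: sum.distrib)
  qed
  finally have D_bound: "card D \<le> card {S \<in> R. S \<subseteq> D} + card {e \<in> T. e \<subseteq> D}" .
  \<comment> \<open>The final partition splits \<open>A \<union> D\<close> according to
    \<open>T\<close> and keeps the classes of \<open>R\<close> outside \<open>D\<close>.\<close>
  let ?X = "A \<union> D" and ?TX = "{e \<in> T. e \<subseteq> A \<union> D}"
  have "{e \<in> T. \<not> e \<subseteq> W - A} \<union> {e \<in> T. e \<subseteq> D} \<subseteq> ?TX"
  proof
    fix e assume "e \<in> {e \<in> T. \<not> e \<subseteq> W - A} \<union> {e \<in> T. e \<subseteq> D}"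
    then consider "e \<in> T" "e \<subseteq> D" | "e \<in> T" "\<not> e \<subseteq> W - A" by auto
    then show "e \<in> ?TX"
    proof cases
      case 2
      \<comment> \<open>An end outside \<open>A\<close> of an edge of \<open>T\<close> meeting
        \<open>A\<close> is missed by \<open>K\<close>, which is maximum in
        \<open>W - A\<close>.\<close>
      have "b \<in> D" if b: "b \<in> e" "b \<notin> A" for b
      proof -
        have "b \<notin> \<Union>K" using matching_unique[OF mT 2(1) _ b(1)] 2(2) by (auto simp: K_def)
        moreover have "b \<in> W - A" using b 2(1) mT by (auto simp: matching_def)
        ultimately show ?thesis using K by (auto simp: D_def missable_def)
      qed
      then show ?thesis using 2(1) by auto
    qed auto
  qed
  then have "card ({e \<in> T. \<not> e \<subseteq> W - A} \<union> {e \<in> T. e \<subseteq> D}) \<le> card ?TX"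
    using finite_matching[OF mT] by (intro card_mono) auto
  moreover have "card ({e \<in> T. \<not> e \<subseteq> W - A} \<union> {e \<in> T. e \<subseteq> D}) = card A + card {e \<in> T. e \<subseteq> D}"
    unfolding cA[symmetric] using finite_matching[OF mT] DW by (intro card_Un_disjoint) auto
  ultimately have TX: "card A + card {e \<in> T. e \<subseteq> D} \<le> card ?TX" by simp
  have XV: "?X \<subseteq> V" using A(1) DW W_subset by auto
  have "matching ?X ?TX" by (rule matching_subset[OF mT]) auto
  note mp = indep_partition_matching[OF this XV]
  let ?RY = "{S \<in> R. \<not> S \<subseteq> D}"
  have "S \<inter> D = {}" if S: "S \<in> ?RY" for S
  proof (rule ccontr)
    assume "S \<inter> D \<noteq> {}"
    then obtain C where C: "C \<in> D // r" "S \<inter> C \<noteq> {}" using part by (fastforce simp: partition_on_def)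
    have "S \<subseteq> C"
      using class_or_disjoint[OF C(1) _ _ C(2)] S R by (auto simp: indep_partition_def partition_on_def)
    then show False using S C part by (auto simp: partition_on_def)
  qed
  then have "\<Union>?RY \<subseteq> V - ?X"
    using R by (auto simp: indep_partition_def partition_on_def)
  moreover have "V - A \<subseteq> \<Union>R"
    using R by (simp add: indep_partition_def partition_on_def)
  then have "V - ?X \<subseteq> \<Union>?RY" by blast
  ultimately have "indep_partition (V - ?X) ?RY" by (intro indep_partition_part[OF R]) auto
  from indep_partition_Un[OF mp(1) this]
  have "indep_partition V (matching_partition ?X ?TX \<union> ?RY)"
    using XV by (simp add: Un_absorb1)
  then have "k \<le> card (matching_partition ?X ?TX \<union> ?RY)" by (rule k_min)
  also have "\<dots> \<le> card (matching_partition ?X ?TX) + card ?RY" by (rule card_Un_le)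
  finally have "k + card ?TX \<le> card ?X + card ?RY" using mp(2) by linarith
  moreover have "card ?X = card A + card D"
    using fA fD DW by (intro card_Un_disjoint) auto
  moreover have "card {S \<in> R. S \<subseteq> D} + card ?RY = card R"
    using fR by (subst card_Un_disjoint[symmetric]) (auto intro: arg_cong[where f = card])
  \<comment> \<open>In \<open>k + card ?TX \<le> card A + card D + card ?RY\<close>, the edges of
    \<open>T\<close> at \<open>A\<close> cancel \<open>card A\<close>, and those inside
    \<open>D\<close> reduce \<open>card D\<close> to at most the number of classes of
    \<open>R\<close> there.\<close>
  ultimately show ?thesis using TX D_bound by linarith
qed

section \<open>The lower bound for the size of the ground set\<close>

lemma card_ground_ge:
  assumes critical: "\<And>v. v \<in> V \<Longrightarrow> \<exists>R. indep_partition (V - {v}) R \<and> card R < k"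
    and connected: "\<And>u v. u \<in> V \<Longrightarrow> v \<in> V \<Longrightarrow> (u, v) \<in> {(x, y). {x, y} \<in> pairs}\<^sup>*"
  shows "2 * k \<le> card V + 1"
proof -
  have le1: "card {S \<in> P. card S = 1} \<le> 1"
  proof (rule ccontr)
    assume "\<not> ?thesis"
    then have "\<not> card (W - \<Union>T) \<le> Suc 0" unfolding card_singletons by simp
    then obtain u v where uv: "u \<in> W - \<Union>T" "v \<in> W - \<Union>T" "u \<noteq> v"
      using card_le_Suc0_iff_eq[of "W - \<Union>T"] finite_W by auto
    obtain A where A: "A \<subseteq> W" "matching_number (W - A) + card A = matching_number W"
      "missable (W - A) \<subseteq> missable W"
      "\<And>x y. x \<in> missable (W - A) \<Longrightarrow> y \<in> W - A \<Longrightarrow> {x, y} \<in> pairs \<Longrightarrow> y \<in> missable (W - A)"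
      using ex_barrier[of W] by blast
    show False
    proof (cases "A = {}")
      case False
      then obtain a where a: "a \<in> A" by auto
      then obtain R where R: "indep_partition (V - {a}) R" "card R < k"
        using critical A(1) W_subset by blast
      \<comment> \<open>Deleting one \<open>a \<in> A\<close> already saves a class; cutting the
        classes down to \<open>V - A\<close> does not increase their number, against
        \<open>card_le_of_barrier\<close>.\<close>
      let ?R = "(\<inter>) (V - A) ` R - {{}}"
      have "partition_on ((V - A) \<inter> (V - {a})) ?R"
        using R(1) by (intro partition_on_restrict) (simp add: indep_partition_def)
      moreover have "(V - A) \<inter> (V - {a}) = V - A" using a by auto
      moreover have "?R \<subseteq> F"
        using R(1) by (auto simp: indep_partition_def intro!: indep_mono[of _ "(V - A) \<inter> _"])
      ultimately have "indep_partition (V - A) ?R" by (simp add: indep_partition_def)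
      then have "k \<le> card ?R"
        using A(4) by (intro card_le_of_barrier[OF A(1,2,3)])
      also have "\<dots> \<le> card ((\<inter>) (V - A) ` R)"
        using finite_indep_partition[OF R(1)] by (intro card_mono) auto
      also have "\<dots> \<le> card R" using finite_indep_partition[OF R(1)] by (rule card_image_le)
      finally show False using R(2) by simp
    next
      case True
      have u: "u \<in> missable W" using uv T_max by (auto simp: missable_def)
      \<comment> \<open>With \<open>A\<close> empty, \<open>missable W\<close> is closed under
        adjacency: inside \<open>W\<close> by the barrier property, towards \<open>V - W\<close> by
        \<open>missable_neighbour\<close>. A path from \<open>u\<close> to \<open>v\<close> thus
        stays inside, and Gallai's lemma forbids \<open>T\<close> to miss both.\<close>
      have "z \<in> missable W \<and> (u, z) \<in> (missable_links W)\<^sup>*"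
        if "(u, z) \<in> {(x, y). {x, y} \<in> pairs}\<^sup>*" for z
        using that
      proof (induction rule: rtrancl_induct)
        case base then show ?case using u by simp
      next
        case (step y z)
        then have yz: "{y, z} \<in> pairs" "y \<in> missable W" by auto
        then have "z \<in> missable W" using missable_neighbour A(4) True by auto
        then have "(y, z) \<in> missable_links W" using yz by (simp add: missable_links_def)
        then show ?case using step.IH \<open>z \<in> missable W\<close> by auto
      qed
      then have "(u, v) \<in> (missable_links W)\<^sup>*" using connected uv W_subset by blast
      then show False using linked_not_both_missed[OF _ uv(3) T_max] uv by blast
    qed
  qed
  have fP: "finite P" using finite_indep_partition[OF P(1)] .
  have "2 * k = (\<Sum>S\<in>P. 2)" using P(2) by simp
  \<comment> \<open>Only a singleton falls short of two, and by one.\<close>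
  also have "\<dots> \<le> (\<Sum>S\<in>P. card S + (if card S = 1 then 1 else 0))"
    using card_part_pos[OF P(1)] by (intro sum_mono) (fastforce simp: not_less_eq_eq)
  also have "\<dots> = card V + card {S \<in> P. card S = 1}"
    using card_eq_sum_indep_partition[OF P(1)]
      sum.inter_filter[OF fP, of "\<lambda>_. 1::nat" "\<lambda>S. card S = 1"]
    by (simp add: sum.distrib)
  finally show ?thesis using le1 by linarith
qed

end

section \<open>Strictly degenerate vertex sets as an independence system\<close>

definition degenerate_sets :: "nat \<Rightarrow> 'a multigraph \<Rightarrow> 'a set set" where
  "degenerate_sets t G = {S. S \<subseteq> verts G \<and> strictly_degenerate t (induced_subgraph G S)}"

lemma strictly_degenerate_subgraph:
  assumes "strictly_degenerate t G" "subgraph H G" shows "strictly_degenerate t H"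
  using assms unfolding strictly_degenerate_def subgraph_def
  by (meson subset_mset.order_trans subset_trans)

lemma multigraph_induced_subgraph: "multigraph G \<Longrightarrow> multigraph (induced_subgraph G S)"
  by (auto simp: multigraph_def induced_subgraph_def)

lemma subgraph_induced_subgraph: "multigraph G \<Longrightarrow> subgraph (induced_subgraph G S) G"
  using multigraph_induced_subgraph[of G S] by (auto simp: subgraph_def induced_subgraph_def)

lemma induced_subgraph_mono:
  assumes "multigraph G" "S \<subseteq> T"
  shows "subgraph (induced_subgraph G S) (induced_subgraph G T)"
  using assms multigraph_induced_subgraph[OF assms(1), of S]
  by (auto simp: subgraph_def induced_subgraph_def subset_iff intro!: mset_subset_eqI)

lemma induced_subgraph_induced_subgraph:
  "S \<subseteq> X \<Longrightarrow> induced_subgraph (induced_subgraph G X) S = induced_subgraph G S"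
  by (auto simp: induced_subgraph_def filter_filter_mset intro!: filter_mset_cong)

lemma edge_in_multigraph: "multigraph G \<Longrightarrow> e \<in># edges G \<Longrightarrow> e \<subseteq> verts G \<and> card e = 2"
  by (auto simp: multigraph_def)

lemma strictly_degenerate_few_edges:
  assumes "size (edges G) \<le> t - 1" shows "strictly_degenerate t G"
  unfolding strictly_degenerate_def
proof (intro allI impI)
  fix H assume H: "subgraph H G \<and> verts H \<noteq> {}"
  then obtain v where "v \<in> verts H" by auto
  moreover have "degree H v \<le> size (edges H)"
    unfolding degree_def by (rule size_filter_mset_lesseq)
  moreover have "size (edges H) \<le> size (edges G)"
    using H by (auto simp: subgraph_def intro: size_mset_mono)
  ultimately show "\<exists>v \<in> verts H. degree H v \<le> t - 1" using assms by force
qed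

text \<open>An edge inside \<open>{u, v}\<close> has two elements and so equals
  \<open>{u, v}\<close>, which leaves fewer than \<open>t\<close> edges. The case
  \<open>u = v\<close> is included and yields the singletons.\<close>

lemma pair_in_degenerate_sets:
  assumes "multigraph G" "u \<in> verts G" "v \<in> verts G" "mult G u v < t"
  shows "{u, v} \<in> degenerate_sets t G"
proof -
  have "{#e \<in># edges G. e \<subseteq> {u, v}#} \<subseteq># {#e \<in># edges G. e = {u, v}#}"
  proof (rule mset_subset_eqI)
    fix e
    have "e = {u, v}" if "e \<in># edges G" "e \<subseteq> {u, v}"
    proof (rule card_seteq)
      show "card {u, v} \<le> card e"
        using edge_in_multigraph[OF assms(1) that(1)] by (simp add: card_insert_if)
    qed (use that in auto)
    then show "count {#e \<in># edges G. e \<subseteq> {u, v}#} e \<le> count {#e \<in># edges G. e = {u, v}#} e"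
      by (auto simp: not_in_iff)
  qed
  then have "size {#e \<in># edges G. e \<subseteq> {u, v}#} \<le> size {#e \<in># edges G. e = {u, v}#}"
    by (rule size_mset_mono)
  also have "\<dots> = mult G u v" by (simp add: filter_eq_replicate_mset mult_def)
  finally have "size (edges (induced_subgraph G {u, v})) \<le> t - 1"
    using assms(4) by (simp add: induced_subgraph_def)
  then show ?thesis
    using assms(2,3) strictly_degenerate_few_edges by (auto simp: degenerate_sets_def)
qed

lemma independence_system_degenerate_sets:
  assumes "multigraph G" "t \<ge> 1"
  shows "independence_system (verts G) (degenerate_sets t G)"
proof
  show "finite (verts G)" using assms by (simp add: multigraph_def)
  show "T \<in> degenerate_sets t G" if "S \<in> degenerate_sets t G" "T \<subseteq> S" for S T
    using that strictly_degenerate_subgraph induced_subgraph_mono[OF assms(1) that(2)]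
    by (auto simp: degenerate_sets_def)
  show "{x} \<in> degenerate_sets t G" if "x \<in> verts G" for x
  proof -
    have "{x} \<notin># edges G" using edge_in_multigraph[OF assms(1), of "{x}"] by auto
    then have "mult G x x < t" using assms(2) by (simp add: mult_def not_in_iff)
    then show ?thesis using pair_in_degenerate_sets[OF assms(1) that that] by simp
  qed
qed (auto simp: degenerate_sets_def)

section \<open>Point partitions as set partitions\<close>

lemma partition_of_point_partition:
  assumes "point_partition t k G c"
  obtains P where "partition_on (verts G) P" "P \<subseteq> degenerate_sets t G" "card P \<le> k"
proof
  \<comment> \<open>Indexing by the colours in use keeps empty classes out; there may be fewer than
    \<open>k\<close> classes.\<close>
  let ?P = "(\<lambda>i. {v \<in> verts G. c v = i}) ` (c ` verts G)"
  have c: "c ` verts G \<subseteq> {..<k}" using assms by (auto simp: point_partition_def)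
  show "partition_on (verts G) ?P" by (auto simp: partition_on_def disjoint_def)
  show "?P \<subseteq> degenerate_sets t G"
    using assms by (auto simp: point_partition_def degenerate_sets_def)
  have "card ?P \<le> card (c ` verts G)"
    using c by (intro card_image_le) (auto intro: finite_subset)
  also have "\<dots> \<le> k" using card_mono[OF _ c] by simp
  finally show "card ?P \<le> k" .
qed

lemma point_partition_of_partition:
  assumes "partition_on (verts G) P" "P \<subseteq> degenerate_sets t G" "finite P"
  shows "\<exists>c. point_partition t (card P) G c"
proof -
  obtain h where h: "bij_betw h P {0..<card P}" using ex_bij_betw_finite_nat[OF assms(3)] by blast
  \<comment> \<open>Well defined on the vertices of \<open>G\<close> since the classes are disjoint;
    elsewhere the value is arbitrary.\<close>
  define part where "part v = (THE S. S \<in> P \<and> v \<in> S)" for v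
  have part: "part v = S" if "S \<in> P" "v \<in> S" for v S
    unfolding part_def
    by (rule the_equality) (use that assms(1) in \<open>auto simp: partition_on_def disjoint_def\<close>)
  have ex: "\<exists>S\<in>P. v \<in> S" if "v \<in> verts G" for v
    using that assms(1) by (auto simp: partition_on_def)
  have "point_partition t (card P) G (\<lambda>v. h (part v))"
    unfolding point_partition_def
  proof (intro conjI ballI allI impI)
    fix v assume "v \<in> verts G"
    then obtain S where "S \<in> P" "v \<in> S" using ex by blast
    then show "h (part v) < card P" using h part by (auto simp: bij_betw_def)
  next
    fix i assume "i < card P"
    then have "i \<in> h ` P" using h by (simp add: bij_betw_def)
    then obtain S where S: "S \<in> P" "h S = i" by auto
    have "{v \<in> verts G. h (part v) = i} = S"
    proof (intro equalityI subsetI)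
      fix v assume v: "v \<in> {v \<in> verts G. h (part v) = i}"
      then obtain S' where S': "S' \<in> P" "v \<in> S'" using ex by blast
      then have "S' = S" using S v h part by (auto simp: bij_betw_def inj_on_def)
      then show "v \<in> S" using S' by simp
    next
      fix v assume "v \<in> S"
      then show "v \<in> {v \<in> verts G. h (part v) = i}"
        using S part assms(1) by (auto simp: partition_on_def)
    qed
    then show "strictly_degenerate t (induced_subgraph G {v \<in> verts G. h (part v) = i})"
      using S(1) assms(2) by (auto simp: degenerate_sets_def)
  qed
  then show ?thesis by blast
qed

lemma ex_point_partition:
  assumes "multigraph G" "t \<ge> 1"
  shows "\<exists>c. point_partition t (point_partition_number t G) G c"
proof -
  interpret independence_system "verts G" "degenerate_sets t G"
    by (rule independence_system_degenerate_sets[OF assms])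
  have "\<exists>c. point_partition t (card ((\<lambda>x. {x}) ` verts G)) G c"
    by (rule point_partition_of_partition)
      (use finite_ground indep_singleton in \<open>auto simp: partition_on_singletons\<close>)
  then show ?thesis unfolding point_partition_number_def by (rule LeastI)
qed

lemma point_partition_number_le: "point_partition t k G c \<Longrightarrow> point_partition_number t G \<le> k"
  unfolding point_partition_number_def by (rule Least_le) blast

section \<open>Critical graphs with connected complement\<close>

lemma chi_critical_delete_vertex:
  assumes "t \<ge> 1" "multigraph G" "chi_critical t G" "v \<in> verts G"
  obtains R where "partition_on (verts G - {v}) R" "R \<subseteq> degenerate_sets t G"
    "card R < point_partition_number t G"
proof -
  let ?H = "induced_subgraph G (verts G - {v})"
  have V: "verts ?H = verts G - {v}" by (auto simp: induced_subgraph_def)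
  then have "?H \<noteq> G" using assms(4) by (metis Diff_iff singletonI)
  then have less: "point_partition_number t ?H < point_partition_number t G"
    using assms(3) subgraph_induced_subgraph[OF assms(2)] by (auto simp: chi_critical_def)
  obtain c where "point_partition t (point_partition_number t ?H) ?H c"
    using ex_point_partition[OF multigraph_induced_subgraph[OF assms(2)] assms(1)] by blast
  then obtain R where R: "partition_on (verts ?H) R" "R \<subseteq> degenerate_sets t ?H"
    "card R \<le> point_partition_number t ?H"
    by (rule partition_of_point_partition)
  have "degenerate_sets t ?H \<subseteq> degenerate_sets t G"
    using induced_subgraph_induced_subgraph[of _ "verts G - {v}" G] by (auto simp: degenerate_sets_def V)
  then show thesis using that[of R] R less unfolding V by auto
qed

text \<open>The complement has edges only between distinct vertices of \<open>G\<close>, so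
  positivity alone supplies the remaining hypotheses of \<open>mult_t_complement\<close>.\<close>

lemma mult_t_complement_posD:
  assumes "multigraph G" "mult (t_complement t G) x y > 0"
  shows "x \<in> verts G" "y \<in> verts G" "x \<noteq> y" "mult G x y < t"
proof -
  have fin: "finite {e. e \<subseteq> verts G \<and> card e = 2}" using assms(1) by (simp add: multigraph_def)
  have "{x, y} \<in># edges (t_complement t G)" using assms(2) by (simp add: mult_def)
  then have "{x, y} \<subseteq> verts G \<and> card {x, y} = 2"
    using fin by (auto simp: t_complement_def set_mset_sum split: if_splits)
  then show xy: "x \<in> verts G" "y \<in> verts G" "x \<noteq> y" by auto
  show "mult G x y < t" using assms(2) mult_t_complement[OF assms(1) xy] by simp
qed

lemma card_verts_ge:
  assumes "t \<ge> 1" "multigraph G" "chi_critical t G" "connected_graph (t_complement t G)"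
  shows "2 * point_partition_number t G \<le> card (verts G) + 1"
proof -
  let ?k = "point_partition_number t G"
  interpret independence_system "verts G" "degenerate_sets t G"
    by (rule independence_system_degenerate_sets[OF assms(2,1)])
  have min: "?k \<le> card Q" if "indep_partition (verts G) Q" for Q
  proof -
    have "\<exists>c. point_partition t (card Q) G c"
      using that finite_indep_partition[OF that]
      by (intro point_partition_of_partition) (auto simp: indep_partition_def)
    then show ?thesis using point_partition_number_le by blast
  qed
  obtain c where "point_partition t ?k G c" using ex_point_partition[OF assms(2,1)] by blast
  then obtain P0 where "partition_on (verts G) P0" "P0 \<subseteq> degenerate_sets t G" "card P0 \<le> ?k"
    by (rule partition_of_point_partition)
  then have P0: "indep_partition (verts G) P0 \<and> card P0 = ?k"
    using min[of P0] by (auto simp: indep_partition_def)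
  obtain P where P: "indep_partition (verts G) P \<and> card P = ?k"
    and best: "\<forall>Q. indep_partition (verts G) Q \<and> card Q = ?k \<longrightarrow>
      card {S \<in> P. card S = 1} \<le> card {S \<in> Q. card S = 1}"
    using ex_has_least_nat[of "\<lambda>Q. indep_partition (verts G) Q \<and> card Q = ?k" P0
        "\<lambda>Q. card {S \<in> Q. card S = 1}"] P0 by blast
  interpret optimal_partition "verts G" "degenerate_sets t G" P ?k
    by unfold_locales (use P min best in auto)
  show ?thesis
  proof (rule card_ground_ge)
    fix v assume "v \<in> verts G"
    then obtain R where "partition_on (verts G - {v}) R" "R \<subseteq> degenerate_sets t G" "card R < ?k"
      using chi_critical_delete_vertex[OF assms(1-3)] by blast
    then show "\<exists>R. indep_partition (verts G - {v}) R \<and> card R < ?k"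
      by (auto simp: indep_partition_def)
  next
    fix u v assume uv: "u \<in> verts G" "v \<in> verts G"
    have "{x, y} \<in> pairs" if "mult (t_complement t G) x y > 0" for x y
      using mult_t_complement_posD[OF assms(2) that] pair_in_degenerate_sets[OF assms(2)] by auto
    then have "{(x, y). mult (t_complement t G) x y > 0} \<subseteq> {(x, y). {x, y} \<in> pairs}" by auto
    moreover have "(u, v) \<in> {(x, y). mult (t_complement t G) x y > 0}\<^sup>*"
      using assms(4) uv by (simp add: connected_graph_def t_complement_def)
    ultimately show "(u, v) \<in> {(x, y). {x, y} \<in> pairs}\<^sup>*" using rtrancl_mono by blast
  qed
qed

section \<open>Multiplicities in critical graphs and Dirac joins\<close>

lemma not_strictly_degenerate_pair:
  assumes "u \<in> verts G" "v \<in> verts G" "u \<noteq> v" "t \<le> mult G u v" "t \<ge> 1"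
  shows "\<not> strictly_degenerate t G"
proof
  assume "strictly_degenerate t G"
  \<comment> \<open>With \<open>t\<close> parallel edges between two vertices, both degrees are
    \<open>t\<close>.\<close>
  define H where "H = \<lparr>verts = {u, v}, edges = replicate_mset t {u, v}\<rparr>"
  have "subgraph H G"
    using assms by (auto simp: H_def subgraph_def multigraph_def mult_def count_le_replicate_mset_subset_eq)
  then obtain w where w: "w \<in> verts H" "degree H w \<le> t - 1"
    using \<open>strictly_degenerate t G\<close> by (force simp: strictly_degenerate_def H_def)
  have "{# e \<in># replicate_mset t {u, v}. w \<in> e #} = replicate_mset t {u, v}"
    using w(1) by (intro filter_mset_eq_conv[THEN iffD2]) (auto simp: H_def)
  then have "degree H w = t" by (simp add: degree_def H_def)
  then show False using w(2) assms(5) by simp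
qed

text \<open>A colouring of \<open>G\<close> without one of its more than \<open>t\<close> parallel edges still separates the two
  ends, so it is a colouring of \<open>G\<close>.\<close>

lemma chi_critical_mult_le:
  assumes "t \<ge> 1" "multigraph G" "chi_critical t G"
  shows "mult G u v \<le> t"
proof (rule ccontr)
  assume more: "\<not> ?thesis"
  then have "{u, v} \<in># edges G" by (simp add: mult_def flip: count_greater_zero_iff)
  then have uv: "u \<in> verts G" "v \<in> verts G" "u \<noteq> v"
    using edge_in_multigraph[OF assms(2), of "{u, v}"] by auto
  define H where "H = \<lparr>verts = verts G, edges = edges G - {#{u, v}#}\<rparr>"
  have mH: "multigraph H" using assms(2) by (auto simp: multigraph_def H_def dest: in_diffD)
  then have "subgraph H G" by (auto simp: subgraph_def H_def)
  moreover have "size (edges H) < size (edges G)"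
    using \<open>{u, v} \<in># edges G\<close> unfolding H_def by (simp add: size_Diff1_less)
  then have "H \<noteq> G" by auto
  ultimately have less: "point_partition_number t H < point_partition_number t G"
    using assms(3) by (simp add: chi_critical_def)
  obtain c where c: "point_partition t (point_partition_number t H) H c"
    using ex_point_partition[OF mH assms(1)] by blast
  have "point_partition t (point_partition_number t H) G c"
    unfolding point_partition_def
  proof (intro conjI ballI allI impI)
    show "c x < point_partition_number t H" if "x \<in> verts G" for x
      using c that by (simp add: point_partition_def H_def)
  next
    fix i assume i: "i < point_partition_number t H"
    let ?S = "{v \<in> verts G. c v = i}"
    have sd: "strictly_degenerate t (induced_subgraph H ?S)"
      using c i by (simp add: point_partition_def H_def)
    have separated: "\<not> {u, v} \<subseteq> ?S"
    proof
      assume S: "{u, v} \<subseteq> ?S"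
      \<comment> \<open>More than \<open>t\<close> edges join \<open>u\<close> and \<open>v\<close>
        in \<open>G\<close>, so at least \<open>t\<close> survive in \<open>H\<close>.\<close>
      then have "mult (induced_subgraph H ?S) u v = mult G u v - 1"
        by (simp add: mult_def induced_subgraph_def H_def)
      then have "\<not> strictly_degenerate t (induced_subgraph H ?S)"
        using S more uv assms(1)
        by (intro not_strictly_degenerate_pair[of u _ v]) (auto simp: induced_subgraph_def H_def)
      then show False using sd by simp
    qed
    have "induced_subgraph H ?S = induced_subgraph G ?S"
      using separated by (simp add: induced_subgraph_def H_def del: insert_subset)
    then show "strictly_degenerate t (induced_subgraph G ?S)" using sd by simp
  qed
  then show False using point_partition_number_le less by fastforce
qed

text \<open>Multiplicities are compared edge by edge: a crossing pair has \<open>t\<close> copies in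
  both graphs, and any other edge of \<open>G\<close> lies inside exactly one of \<open>X\<close>
  and \<open>Y\<close>.\<close>

lemma dirac_join_induced_subgraphs:
  assumes G: "multigraph G" and XY: "X \<union> Y = verts G" "X \<inter> Y = {}"
    and join: "\<And>x y. x \<in> X \<Longrightarrow> y \<in> Y \<Longrightarrow> mult G x y = t"
  shows "G = dirac_join t (induced_subgraph G X) (induced_subgraph G Y)"
proof -
  let ?J = "dirac_join t (induced_subgraph G X) (induced_subgraph G Y)"
  have V: "verts (induced_subgraph G X) = X" "verts (induced_subgraph G Y) = Y"
    using XY by (auto simp: induced_subgraph_def)
  have fin: "finite (X \<times> Y)" using G XY by (auto simp: multigraph_def intro: finite_subset)
  have "count (edges G) e = count (edges ?J) e" for e
  proof (cases "\<exists>x\<in>X. \<exists>y\<in>Y. e = {x, y}")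
    case True
    then obtain x y where xy: "x \<in> X" "y \<in> Y" "e = {x, y}" by blast
    have "mult ?J x y = t"
      using multigraph_induced_subgraph[OF G] XY(2) xy V by (intro mult_dirac_join) auto
    then show ?thesis using join[OF xy(1,2)] xy(3) by (simp add: mult_def)
  next
    case False
    then have "(\<Sum>p\<in>X \<times> Y. count (case p of (x, y) \<Rightarrow> replicate_mset t {x, y}) e) = 0"
      by (intro sum.neutral) auto
    then have J: "count (edges ?J) e = count (edges (induced_subgraph G X)) e + count (edges (induced_subgraph G Y)) e"
      using fin by (simp add: dirac_join_def V count_sum)
    show ?thesis
    proof (cases "e \<in># edges G")
      case True
      then have e: "e \<subseteq> X \<union> Y" "card e = 2" using edge_in_multigraph[OF G] XY(1) by auto
      then obtain a b where ab: "e = {a, b}" "a \<noteq> b" by (meson card_2_iff)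
      have "e \<subseteq> X \<or> e \<subseteq> Y" using e(1) False unfolding ab(1) by (auto simp: insert_commute)
      moreover have "\<not> (e \<subseteq> X \<and> e \<subseteq> Y)" using XY(2) ab(1) by auto
      ultimately show ?thesis using J by (auto simp: induced_subgraph_def)
    next
      case False
      then show ?thesis using J by (simp add: induced_subgraph_def not_in_iff)
    qed
  qed
  then have "edges G = edges ?J" by (rule multiset_eqI)
  moreover have "verts ?J = verts G" using V XY(1) by (simp add: dirac_join_def)
  ultimately show ?thesis by simp
qed

lemma disconnected_imp_t_decomposable:
  assumes "t \<ge> 1" "multigraph G" "chi_critical t G" "\<not> connected_graph (t_complement t G)"
  shows "t_decomposable t G"
proof -
  let ?r = "{(x, y). mult (t_complement t G) x y > 0}"
  have "verts (t_complement t G) = verts G" by (simp add: t_complement_def)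
  then obtain u v where uv: "u \<in> verts G" "v \<in> verts G" "(u, v) \<notin> ?r\<^sup>*"
    using assms(4) by (auto simp: connected_graph_def)
  define X where "X = {x \<in> verts G. (u, x) \<in> ?r\<^sup>*}"
  define Y where "Y = verts G - X"
  have XY: "X \<union> Y = verts G" "X \<inter> Y = {}" by (auto simp: X_def Y_def)
  have "mult G x y = t" if "x \<in> X" "y \<in> Y" for x y
  proof -
    have x: "x \<in> verts G" "(u, x) \<in> ?r\<^sup>*" and y: "y \<in> verts G" "(u, y) \<notin> ?r\<^sup>*" "x \<noteq> y"
      using that by (auto simp: X_def Y_def)
    have "(x, y) \<notin> ?r" using x(2) y(2) by (meson rtrancl.rtrancl_into_rtrancl)
    \<comment> \<open>The truncated subtraction yields only \<open>mult G x y \<ge> t\<close>;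
      \<open>chi_critical_mult_le\<close> supplies the other direction.\<close>
    then have "t - mult G x y = 0" using mult_t_complement[OF assms(2) x(1) y(1,3)] by simp
    then show ?thesis using chi_critical_mult_le[OF assms(1-3), of x y] by simp
  qed
  then have "G = dirac_join t (induced_subgraph G X) (induced_subgraph G Y)"
    by (rule dirac_join_induced_subgraphs[OF assms(2) XY])
  moreover have "u \<in> X" "v \<in> Y" using uv by (auto simp: X_def Y_def)
  ultimately show ?thesis
    unfolding t_decomposable_def using subgraph_induced_subgraph[OF assms(2)] XY
    by (intro exI[of _ "induced_subgraph G X"] exI[of _ "induced_subgraph G Y"])
      (auto simp: induced_subgraph_def)
qed

theorem theorem17:
  fixes t :: nat and G :: "'a multigraph"
  assumes "t \<ge> 1"
    and "multigraph G"
    and "chi_critical t G"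
  shows "(connected_graph (t_complement t G) \<longrightarrow>
            int (card (verts G)) \<ge> 2 * int (point_partition_number t G) - 1) \<and>
         (int (card (verts G)) \<le> 2 * int (point_partition_number t G) - 2 \<longrightarrow>
            t_decomposable t G)"
proof -
  have bound: "int (card (verts G)) \<ge> 2 * int (point_partition_number t G) - 1"
    if "connected_graph (t_complement t G)"
    using card_verts_ge[OF assms that] by linarith
  then show ?thesis using disconnected_imp_t_decomposable[OF assms] by fastforce
qed

end
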